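(* Let $p \ge q \ge 1$, and let $P$ be an $n$-point set in $\mathbb{R}^d$. Let $t\in \mathbb{R}^d$ be such that for all $i\in\{1,\dots,d\}$, $|\{x\in P: x_i < t_i\}| = |\{x\in P: x_i > t_i\}|$. Then the map $g:\ell_p^d \to \ell_q^d$ defined by $g(x) = \tilde{M}_{p,q}(x-t)$ has $q$-average distortion $D \lesssim \frac{p}{q}$ with respect to $P$.
   Context: The Mazur map $M_{p,q}:\mathbb{R}^d\to\mathbb{R}^d$ is $M_{p,q}(x)_i=\mathrm{sign}(x_i)|x_i|^{p/q}$, and $\tilde{M}_{p,q}(x)=\|x\|_p M_{p,q}(x/\|x\|_p)=\|x\|_p^{1-p/q}M_{p,q}(x)$ for $x\ne0$, $\tilde M_{p,q}(0)=0$. For a map $g$ between metric spaces, $\|g\|_{\mathrm{Lip}}$ is its Lipschitz constant. $g:\ell_p^d\to\ell_q^d$ has $q$-average distortion $D$ with respect to $P$ if $\sum_{x,y\in P}\|g(x)-g(y)\|_q^q\ge\frac{\|g\|_{\mathrm{Lip}}^q}{D^q}\sum_{x,y\in P}\|x-y\|_p^q$, where $\|g\|_{\mathrm{Lip}}$ is computed with respect to $\|\cdot\|_p$ on the domain and $\|\cdot\|_q$ on the range. $A\lesssim B$ means $A\le C_0B$ for an absolute constant $C_0$. *)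

theory Defs
  imports Complex_Main "Jordan_Normal_Form.Matrix"
begin

text \<open>
  \<open>\<real>\<^sup>d\<close> is \<^term>\<open>carrier_vec d :: real vec set\<close>, with coordinates indexed by \<open>0, \<dots>, d - 1\<close>:
  the dimension has to be a term so that a constant can be chosen independently of it.
\<close>

definition lp_norm :: "real \<Rightarrow> real vec \<Rightarrow> real" where
  "lp_norm p x = (\<Sum>i<dim_vec x. \<bar>x $ i\<bar> powr p) powr (1 / p)"

definition lp_dist :: "real \<Rightarrow> real vec \<Rightarrow> real vec \<Rightarrow> real" where
  "lp_dist p x y = lp_norm p (x - y)"

definition mazur :: "real \<Rightarrow> real \<Rightarrow> real vec \<Rightarrow> real vec" where
  "mazur p q x = vec (dim_vec x) (\<lambda>i. sgn (x $ i) * \<bar>x $ i\<bar> powr (p / q))"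

definition mazur_tilde :: "real \<Rightarrow> real \<Rightarrow> real vec \<Rightarrow> real vec" where
  "mazur_tilde p q x =
     (if x = 0\<^sub>v (dim_vec x) then 0\<^sub>v (dim_vec x)
      else lp_norm p x \<cdot>\<^sub>v mazur p q ((1 / lp_norm p x) \<cdot>\<^sub>v x))"

definition lip_bound ::
  "'a set \<Rightarrow> ('a \<Rightarrow> 'a \<Rightarrow> real) \<Rightarrow> ('b \<Rightarrow> 'b \<Rightarrow> real) \<Rightarrow> ('a \<Rightarrow> 'b) \<Rightarrow> real \<Rightarrow> bool" where
  "lip_bound X dX dY g L \<longleftrightarrow> 0 \<le> L \<and> (\<forall>x\<in>X. \<forall>y\<in>X. dY (g x) (g y) \<le> L * dX x y)"

text \<open>The least Lipschitz bound; only meaningful if some bound exists.\<close>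

definition lip_const ::
  "'a set \<Rightarrow> ('a \<Rightarrow> 'a \<Rightarrow> real) \<Rightarrow> ('b \<Rightarrow> 'b \<Rightarrow> real) \<Rightarrow> ('a \<Rightarrow> 'b) \<Rightarrow> real" where
  "lip_const X dX dY g = Inf {L. lip_bound X dX dY g L}"

text \<open>
  The existence of a Lipschitz bound is required explicitly, since \<^const>\<open>lip_const\<close> is
  unspecified otherwise, and \<open>0 < D\<close> is required because division by \<open>0\<close> yields \<open>0\<close>.
  The Lipschitz constant is taken on all of \<open>\<real>\<^sup>d\<close>, not just on \<open>P\<close>.
\<close>

definition has_average_distortion ::
  "nat \<Rightarrow> real \<Rightarrow> real \<Rightarrow> (real vec \<Rightarrow> real vec) \<Rightarrow> real vec set \<Rightarrow> real \<Rightarrow> bool" where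
  "has_average_distortion d p q g P D \<longleftrightarrow>
     0 < D \<and>
     (\<exists>L. lip_bound (carrier_vec d) (lp_dist p) (lp_dist q) g L) \<and>
     (\<Sum>x\<in>P. \<Sum>y\<in>P. lp_dist q (g x) (g y) powr q) \<ge>
       lip_const (carrier_vec d) (lp_dist p) (lp_dist q) g powr q / D powr q *
         (\<Sum>x\<in>P. \<Sum>y\<in>P. lp_dist p x y powr q)"

end

theory Submission
  imports Defs "HOL-Analysis.Convex"
begin

text \<open>
  Since the map is homogeneous of degree \<open>1\<close> and \<open>\<parallel>g x\<parallel>\<^sub>q = \<parallel>x - t\<parallel>\<^sub>p\<close>, both sides of the distortion
  inequality can be compared with \<open>n \<Sum>\<^sub>x \<parallel>x - t\<parallel>\<^sub>p\<^sup>q\<close>. The triangle inequality bounds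
  \<open>\<Sum>\<^sub>x\<^sub>,\<^sub>y \<parallel>x - y\<parallel>\<^sub>p\<^sup>q\<close> by \<open>2\<^sup>q\<close> times this. Conversely, \<open>g\<close> preserves the sign of each coordinate of
  \<open>x - t\<close>, so \<open>0\<close> is a coordinatewise median of \<open>g(P)\<close>: for each \<open>x\<close> and \<open>i\<close>, at least half of the \<open>y\<close>
  have \<open>\<bar>g(x)\<^sub>i - g(y)\<^sub>i\<bar> \<ge> \<bar>g(x)\<^sub>i\<bar>\<close>, whence \<open>\<Sum>\<^sub>x\<^sub>,\<^sub>y \<parallel>g x - g y\<parallel>\<^sub>q\<^sup>q\<close> is at least half of it. Thus
  \<open>D = 4 L\<close> works for every Lipschitz bound \<open>L > 0\<close>. Writing \<open>r = p / q\<close>, one may take \<open>L = 3 r\<close>: for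
  \<open>\<parallel>y\<parallel>\<^sub>p \<le> \<parallel>x\<parallel>\<^sub>p\<close>, the difference of the unnormalised Mazur maps contributes \<open>2 r \<parallel>x - y\<parallel>\<^sub>p\<close> by
  \<open>\<bar>u\<^sup>r - v\<^sup>r\<bar> \<le> r \<bar>u - v\<bar> max(u, v)\<^sup>r\<^sup>-\<^sup>1\<close> and Hoelder's inequality with exponents \<open>r\<close> and \<open>r / (r - 1)\<close>,
  and the change of the normalising factor \<open>\<parallel>x\<parallel>\<^sub>p\<^sup>1\<^sup>-\<^sup>r\<close> contributes \<open>(r - 1) \<parallel>x - y\<parallel>\<^sub>p\<close> by Bernoulli's
  inequality.
\<close>

section \<open>Scalar convexity inequalities and Hoelder's inequality\<close>

text \<open>Young's inequality for positive arguments; a zero argument makes the left-hand side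
  vanish even for exponent 0, since \<open>0 powr 0 = 0\<close>.\<close>

lemma weighted_amgm:
  fixes a b :: real
  assumes "0 \<le> \<alpha>" "0 \<le> \<beta>" "\<alpha> + \<beta> = 1" "0 \<le> a" "0 \<le> b"
  shows "a powr \<alpha> * b powr \<beta> \<le> \<alpha> * a + \<beta> * b"
proof (cases "a = 0 \<or> b = 0")
  case True
  then show ?thesis using assms by auto
next
  case False
  then show ?thesis using Youngs_inequality_0[OF assms(1-3), of a b] assms by simp
qed

text \<open>AM-GM for \<open>s powr r\<close> and 1 with weights 1/r and 1 - 1/r, multiplied by
  r.\<close>

lemma bernoulli_powr:
  fixes s r :: real
  assumes "0 \<le> s" "1 \<le> r"
  shows "1 + r * (s - 1) \<le> s powr r"
proof -
  have "(s powr r) powr (1/r) * 1 powr (1 - 1/r) \<le> (1/r) * s powr r + (1 - 1/r) * 1"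
    using assms by (intro weighted_amgm) auto
  then have "s \<le> (1/r) * s powr r + (1 - 1/r)"
    using assms by (simp add: powr_powr)
  then have "r * s \<le> r * ((1/r) * s powr r + (1 - 1/r))"
    using assms by (intro mult_left_mono) auto
  also have "\<dots> = s powr r + r - 1"
    using assms by (simp add: field_simps)
  finally show ?thesis by (simp add: algebra_simps)
qed

text \<open>Averages the tangent line inequality at the mean, which, unlike \<open>powr_convex\<close>, includes the endpoint \<open>0\<close>.\<close>

lemma powr_convex_nonneg:
  fixes u v r :: real
  assumes "0 \<le> \<alpha>" "0 \<le> \<beta>" "\<alpha> + \<beta> = 1" "0 \<le> u" "0 \<le> v" "1 \<le> r"
  shows "(\<alpha> * u + \<beta> * v) powr r \<le> \<alpha> * u powr r + \<beta> * v powr r"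
proof -
  define m where "m = \<alpha> * u + \<beta> * v"
  have m0: "0 \<le> m" unfolding m_def using assms by simp
  show ?thesis
  proof (cases "m = 0")
    case True
    then show ?thesis using assms m_def by simp
  next
    case False
    then have m: "0 < m" using m0 by simp
    have "\<alpha> * (1 + r * (u/m - 1)) + \<beta> * (1 + r * (v/m - 1))
        \<le> \<alpha> * (u/m) powr r + \<beta> * (v/m) powr r"
      using assms m by (intro add_mono mult_left_mono bernoulli_powr) auto
    moreover have "\<alpha> * (1 + r * (u/m - 1)) + \<beta> * (1 + r * (v/m - 1))
        = (\<alpha> + \<beta>) * (1 - r) + r * ((\<alpha> * u + \<beta> * v) / m)"
      by (simp add: algebra_simps add_divide_distrib)
    ultimately have "1 \<le> \<alpha> * (u/m) powr r + \<beta> * (v/m) powr r"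
      using assms m by (simp flip: m_def)
    also have "\<dots> = (\<alpha> * u powr r + \<beta> * v powr r) / m powr r"
      by (simp add: powr_divide add_divide_distrib)
    finally show ?thesis using m by (simp add: field_simps m_def)
  qed
qed

text \<open>Normalising both sums to 1 reduces this to AM-GM in each term. Stating it with weights
  instead of conjugate exponents admits the weight 0, which occurs when p = q.\<close>

lemma hoelder_sum:
  fixes u v :: "'i \<Rightarrow> real"
  assumes "finite A" "0 \<le> \<alpha>" "0 \<le> \<beta>" "\<alpha> + \<beta> = 1"
    and u: "\<And>i. i \<in> A \<Longrightarrow> 0 \<le> u i" and v: "\<And>i. i \<in> A \<Longrightarrow> 0 \<le> v i"
  shows "(\<Sum>i\<in>A. u i powr \<alpha> * v i powr \<beta>) \<le> (\<Sum>i\<in>A. u i) powr \<alpha> * (\<Sum>i\<in>A. v i) powr \<beta>"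
proof -
  define U V where "U = (\<Sum>i\<in>A. u i)" and "V = (\<Sum>i\<in>A. v i)"
  have "0 \<le> U" "0 \<le> V" unfolding U_def V_def using u v by (auto intro: sum_nonneg)
  show ?thesis
  proof (cases "U = 0 \<or> V = 0")
    case True
    then have "(\<forall>i\<in>A. u i = 0) \<or> (\<forall>i\<in>A. v i = 0)"
      unfolding U_def V_def using assms by (simp add: sum_nonneg_eq_0_iff)
    then have "(\<Sum>i\<in>A. u i powr \<alpha> * v i powr \<beta>) = 0" by auto
    then show ?thesis by simp
  next
    case False
    then have UV: "0 < U" "0 < V" using \<open>0 \<le> U\<close> \<open>0 \<le> V\<close> by auto
    have "(\<Sum>i\<in>A. u i powr \<alpha> * v i powr \<beta>) / (U powr \<alpha> * V powr \<beta>)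
        = (\<Sum>i\<in>A. (u i / U) powr \<alpha> * (v i / V) powr \<beta>)"
      by (simp add: powr_divide sum_divide_distrib)
    also have "\<dots> \<le> (\<Sum>i\<in>A. \<alpha> * (u i / U) + \<beta> * (v i / V))"
      using assms UV by (intro sum_mono weighted_amgm) auto
    also have "\<dots> = \<alpha> * (U / U) + \<beta> * (V / V)"
      by (simp only: sum.distrib sum_distrib_left[symmetric] sum_divide_distrib[symmetric] U_def V_def)
    also have "\<dots> = 1" using UV assms by simp
    finally show ?thesis using UV by (simp add: field_simps U_def V_def)
  qed
qed

section \<open>The p-norm of functions on an index set\<close>

definition pnorm :: "real \<Rightarrow> 'i set \<Rightarrow> ('i \<Rightarrow> real) \<Rightarrow> real" where
  "pnorm p A f = (\<Sum>i\<in>A. \<bar>f i\<bar> powr p) powr (1 / p)"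

lemma pnorm_nonneg [simp]: "0 \<le> pnorm p A f"
  by (simp add: pnorm_def)

lemma pnorm_powr: "0 < p \<Longrightarrow> pnorm p A f powr p = (\<Sum>i\<in>A. \<bar>f i\<bar> powr p)"
  by (simp add: pnorm_def powr_powr sum_nonneg)

lemma pnorm_powr_any: "pnorm p A f powr e = (\<Sum>i\<in>A. \<bar>f i\<bar> powr p) powr (e / p)"
  by (simp add: pnorm_def powr_powr)

lemma pnorm_eq_0_iff:
  assumes "finite A" "0 < p"
  shows "pnorm p A f = 0 \<longleftrightarrow> (\<forall>i\<in>A. f i = 0)"
  using assms by (simp add: pnorm_def sum_nonneg_eq_0_iff)

lemma pnorm_cmult:
  assumes "0 < p"
  shows "pnorm p A (\<lambda>i. c * f i) = \<bar>c\<bar> * pnorm p A f"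
  using assms
  by (simp add: pnorm_def abs_mult powr_mult powr_powr flip: sum_distrib_left)

lemma pnorm_minus_commute: "pnorm p A (\<lambda>i. f i - g i) = pnorm p A (\<lambda>i. g i - f i)"
  by (simp add: pnorm_def abs_minus_commute)

lemma le_pnormI:
  assumes "0 < p" "0 \<le> c" "(\<Sum>i\<in>A. \<bar>f i\<bar> powr p) \<le> c powr p"
  shows "pnorm p A f \<le> c"
proof -
  have "pnorm p A f \<le> (c powr p) powr (1 / p)"
    unfolding pnorm_def using assms by (intro powr_mono2) (auto intro: sum_nonneg)
  then show ?thesis using assms by (simp add: powr_powr)
qed

text \<open>Minkowski's inequality: f + g is a + b times a convex combination of f / a and g / b, so
  convexity of the p-th power applies pointwise, and both normalised functions have p-th powers
  summing to 1.\<close>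

lemma pnorm_triangle:
  assumes A: "finite A" and p: "1 \<le> p"
  shows "pnorm p A (\<lambda>i. f i + g i) \<le> pnorm p A f + pnorm p A g"
proof -
  define a b where "a = pnorm p A f" and "b = pnorm p A g"
  have ab0: "0 \<le> a" "0 \<le> b" by (simp_all add: a_def b_def)
  consider "a = 0" | "b = 0" | "0 < a" "0 < b" using ab0 by fastforce
  then show ?thesis
  proof cases
    case 1
    then have "\<forall>i\<in>A. f i = 0" using pnorm_eq_0_iff[of A p f] A p by (simp add: a_def)
    then have "pnorm p A (\<lambda>i. f i + g i) = pnorm p A g" by (simp add: pnorm_def)
    then show ?thesis by simp
  next
    case 2
    then have "\<forall>i\<in>A. g i = 0" using pnorm_eq_0_iff[of A p g] A p by (simp add: b_def)
    then have "pnorm p A (\<lambda>i. f i + g i) = pnorm p A f" by (simp add: pnorm_def)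
    then show ?thesis by simp
  next
    case 3
    define \<alpha> \<beta> where "\<alpha> = a / (a + b)" and "\<beta> = b / (a + b)"
    have \<alpha>\<beta>: "0 \<le> \<alpha>" "0 \<le> \<beta>" "\<alpha> + \<beta> = 1"
      using 3 by (auto simp: \<alpha>_def \<beta>_def simp flip: add_divide_distrib)
    have "(\<Sum>i\<in>A. \<bar>f i + g i\<bar> powr p)
        \<le> (\<Sum>i\<in>A. (a + b) powr p * (\<alpha> * (\<bar>f i\<bar> / a) powr p + \<beta> * (\<bar>g i\<bar> / b) powr p))"
    proof (rule sum_mono)
      fix i
      have "\<bar>f i + g i\<bar> powr p \<le> ((a + b) * (\<alpha> * (\<bar>f i\<bar> / a) + \<beta> * (\<bar>g i\<bar> / b))) powr p"
        using 3 p by (intro powr_mono2) (auto simp: \<alpha>_def \<beta>_def distrib_left)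
      also have "\<dots> \<le> (a + b) powr p * (\<alpha> * (\<bar>f i\<bar> / a) powr p + \<beta> * (\<bar>g i\<bar> / b) powr p)"
        unfolding powr_mult using 3 p \<alpha>\<beta> by (intro mult_left_mono powr_convex_nonneg) auto
      finally show "\<bar>f i + g i\<bar> powr p
          \<le> (a + b) powr p * (\<alpha> * (\<bar>f i\<bar> / a) powr p + \<beta> * (\<bar>g i\<bar> / b) powr p)" .
    qed
    also have "\<dots> = (a + b) powr p * (\<alpha> * ((\<Sum>i\<in>A. \<bar>f i\<bar> powr p) / a powr p)
        + \<beta> * ((\<Sum>i\<in>A. \<bar>g i\<bar> powr p) / b powr p))"
      by (simp only: powr_divide sum.distrib sum_distrib_left sum_divide_distrib distrib_left
          times_divide_eq_right)
    also have "\<dots> = (a + b) powr p"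
      using 3 p \<alpha>\<beta> by (simp add: a_def b_def flip: pnorm_powr)
    finally show ?thesis using 3 p by (intro le_pnormI) (auto simp: a_def b_def)
  qed
qed

section \<open>Lipschitz estimates for the unnormalised Mazur map\<close>

text \<open>With r = p / q this is the Mazur map in a single coordinate.\<close>

definition spow :: "real \<Rightarrow> real \<Rightarrow> real" where
  "spow r u = sgn u * \<bar>u\<bar> powr r"

lemma abs_spow: "\<bar>spow r u\<bar> = \<bar>u\<bar> powr r"
  by (auto simp: spow_def abs_mult sgn_if)

text \<open>Bernoulli's inequality at v / u, scaled by \<open>u powr r\<close>: the graph lies above
  its tangent at u.\<close>

lemma powr_diff_le:
  fixes u v r :: real
  assumes "0 \<le> v" "v \<le> u" "1 \<le> r"
  shows "u powr r - v powr r \<le> r * (u - v) * u powr (r - 1)"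
proof (cases "u = 0")
  case True
  then show ?thesis using assms by simp
next
  case False
  then have u: "0 < u" using assms by simp
  have "1 + r * (v / u - 1) \<le> (v / u) powr r"
    using assms u by (intro bernoulli_powr) auto
  then have "u powr r * (1 + r * (v / u - 1)) \<le> u powr r * (v / u) powr r"
    by (intro mult_left_mono) auto
  also have "\<dots> = v powr r" using u by (simp add: powr_divide)
  also have "u powr r * (1 + r * (v / u - 1)) = u powr r - r * (u - v) * (u powr r / u)"
    using u by (simp add: field_simps)
  finally show ?thesis using u by (simp add: powr_diff)
qed

text \<open>By oddness and symmetry it suffices to treat u \<ge> |v|. Equal signs are covered by
  \<open>powr_diff_le\<close>; for opposite signs the two powers add up, and each is at most its
  base times \<open>u powr (r - 1)\<close>.\<close>

lemma spow_diff_le: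
  fixes u v r :: real
  assumes r: "1 \<le> r"
  shows "\<bar>spow r u - spow r v\<bar> \<le> r * \<bar>u - v\<bar> * max \<bar>u\<bar> \<bar>v\<bar> powr (r - 1)"
proof -
  have pos: "\<bar>spow r u - spow r v\<bar> \<le> r * \<bar>u - v\<bar> * max \<bar>u\<bar> \<bar>v\<bar> powr (r - 1)"
    if "0 \<le> v" "\<bar>v\<bar> \<le> u" for u v
  proof -
    have "v powr r \<le> u powr r" using that r by (intro powr_mono2) auto
    moreover have "spow r w = w powr r" if "0 \<le> w" for w
      using that by (simp add: spow_def sgn_if)
    moreover have "max \<bar>u\<bar> \<bar>v\<bar> = u" "\<bar>u - v\<bar> = u - v" "0 \<le> u" using that by auto
    ultimately show ?thesis using powr_diff_le[of v u r] that r by simp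
  qed
  have neg: "\<bar>spow r u - spow r v\<bar> \<le> r * \<bar>u - v\<bar> * max \<bar>u\<bar> \<bar>v\<bar> powr (r - 1)"
    if "v < 0" "\<bar>v\<bar> \<le> u" for u v
  proof -
    have "\<bar>spow r u - spow r v\<bar> = u * u powr (r - 1) + (-v) * (-v) powr (r - 1)"
      using that by (simp add: spow_def powr_diff)
    also have "\<dots> \<le> u * u powr (r - 1) + (-v) * u powr (r - 1)"
      using that r by (intro add_left_mono mult_left_mono powr_mono2) auto
    also have "\<dots> = 1 * ((u - v) * u powr (r - 1))" by (simp add: algebra_simps)
    also have "\<dots> \<le> r * ((u - v) * u powr (r - 1))"
      using that r by (intro mult_right_mono) auto
    finally show ?thesis using that by (simp add: max_def mult.assoc)
  qed
  have dom: "\<bar>spow r u - spow r v\<bar> \<le> r * \<bar>u - v\<bar> * max \<bar>u\<bar> \<bar>v\<bar> powr (r - 1)"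
    if "\<bar>v\<bar> \<le> u" for u v
    using pos[of v u] neg[of v u] that by linarith
  have odd: "spow r (- w) = - spow r w" for w by (simp add: spow_def sgn_if)
  consider "\<bar>v\<bar> \<le> u" | "\<bar>- v\<bar> \<le> - u" | "\<bar>u\<bar> \<le> v" | "\<bar>- u\<bar> \<le> - v" by linarith
  then show ?thesis
  proof cases
    case 1 then show ?thesis by (rule dom)
  next
    case 2 from dom[OF this] show ?thesis by (simp add: odd abs_minus_commute)
  next
    case 3 from dom[OF this] show ?thesis by (simp add: abs_minus_commute max.commute)
  next
    case 4 from dom[OF this] show ?thesis by (simp add: odd abs_minus_commute max.commute)
  qed
qed

lemma pnorm_spow:
  assumes "0 < p" "0 < q"
  shows "pnorm q A (\<lambda>i. spow (p / q) (f i)) = pnorm p A f powr (p / q)"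
proof -
  have "p / q * q = p" "1 / p * (p / q) = 1 / q" using assms by simp_all
  then show ?thesis by (simp only: pnorm_def abs_spow powr_powr)
qed

lemma pnorm_spow_diff_le:
  assumes A: "finite A" and q: "1 \<le> q" "q \<le> p" and le: "pnorm p A g \<le> pnorm p A f"
  shows "pnorm q A (\<lambda>i. spow (p / q) (f i) - spow (p / q) (g i))
    \<le> 2 * (p / q) * pnorm p A (\<lambda>i. f i - g i) * pnorm p A f powr (p / q - 1)"
proof -
  define r where "r = p / q"
  have r: "1 \<le> r" using q by (simp add: r_def)
  define m where "m i = max \<bar>f i\<bar> \<bar>g i\<bar>" for i
  define S where "S = (\<Sum>i\<in>A. m i powr p)"
  define a D where "a = pnorm p A f" and "D = pnorm p A (\<lambda>i. f i - g i)"
  \<comment> \<open>The exponent that the Hoelder weight 1 - q / p of \<open>S\<close> becomes after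
    taking the q-th root. As \<open>e\<close> \<le> 1, the factor 2 in the bound on \<open>S\<close>
    contributes at most 2.\<close>
  define e where "e = 1/q - 1/p"
  have pq: "p \<noteq> 0" "q \<noteq> 0" using q by auto
  then have exps: "p * e = r - 1" "e * q = 1 - q / p" "p * (1 - q / p) = (r - 1) * q" "p * (q / p) = q"
    by (simp_all add: e_def r_def field_simps)
  have "1 / p \<le> 1 / q" "1 / q \<le> 1" "0 \<le> 1 / p"
    using q by (auto intro: divide_left_mono)
  then have e: "0 \<le> e" "e \<le> 1" unfolding e_def by linarith+
  have S0: "0 \<le> S" by (simp add: S_def sum_nonneg)
  have "S \<le> (\<Sum>i\<in>A. \<bar>f i\<bar> powr p + \<bar>g i\<bar> powr p)"
    unfolding S_def by (intro sum_mono) (auto simp: m_def max_def)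
  also have "\<dots> = a powr p + pnorm p A g powr p"
    using q by (simp add: sum.distrib pnorm_powr a_def)
  also have "\<dots> \<le> 2 * a powr p"
    using le q powr_mono2[of p "pnorm p A g" a] by (simp add: a_def)
  finally have S: "S \<le> 2 * a powr p" .
  have "S powr e \<le> (2 * a powr p) powr e"
    using e S0 S by (intro powr_mono2)
  also have "\<dots> = 2 powr e * a powr (r - 1)"
    by (simp add: powr_mult powr_powr exps)
  also have "\<dots> \<le> 2 powr 1 * a powr (r - 1)"
    using e by (intro mult_right_mono powr_mono) auto
  finally have Se: "S powr e \<le> 2 * a powr (r - 1)" by simp
  have "(\<Sum>i\<in>A. \<bar>spow r (f i) - spow r (g i)\<bar> powr q)
      \<le> (\<Sum>i\<in>A. r powr q * ((\<bar>f i - g i\<bar> powr p) powr (q / p) * (m i powr p) powr (1 - q / p)))"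
  proof (rule sum_mono)
    fix i
    have "\<bar>spow r (f i) - spow r (g i)\<bar> powr q \<le> (r * \<bar>f i - g i\<bar> * m i powr (r - 1)) powr q"
      unfolding m_def using q r by (intro powr_mono2 spow_diff_le) auto
    also have "\<dots> = r powr q * ((\<bar>f i - g i\<bar> powr p) powr (q / p) * (m i powr p) powr (1 - q / p))"
      by (simp only: powr_mult powr_powr exps mult.assoc)
    finally show "\<bar>spow r (f i) - spow r (g i)\<bar> powr q
        \<le> r powr q * ((\<bar>f i - g i\<bar> powr p) powr (q / p) * (m i powr p) powr (1 - q / p))" .
  qed
  also have "\<dots> = r powr q * (\<Sum>i\<in>A. (\<bar>f i - g i\<bar> powr p) powr (q / p) * (m i powr p) powr (1 - q / p))"
    by (simp add: sum_distrib_left)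
  also have "\<dots> \<le> r powr q * ((\<Sum>i\<in>A. \<bar>f i - g i\<bar> powr p) powr (q / p) * S powr (1 - q / p))"
    unfolding S_def using A q by (intro mult_left_mono hoelder_sum) auto
  also have "\<dots> = (r * D * S powr e) powr q"
    by (simp add: powr_mult powr_powr D_def pnorm_powr_any exps)
  finally have "pnorm q A (\<lambda>i. spow r (f i) - spow r (g i)) \<le> r * D * S powr e"
    using q r by (intro le_pnormI) (auto simp: D_def)
  also have "\<dots> \<le> r * D * (2 * a powr (r - 1))"
    using Se r by (intro mult_left_mono) (auto simp: D_def)
  finally show ?thesis by (simp add: r_def D_def a_def mult_ac)
qed

section \<open>The normalised Mazur map and its Lipschitz bound\<close>

definition tmazur :: "real \<Rightarrow> real \<Rightarrow> 'i set \<Rightarrow> ('i \<Rightarrow> real) \<Rightarrow> 'i \<Rightarrow> real" where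
  "tmazur p q A f i = pnorm p A f powr (1 - p / q) * spow (p / q) (f i)"

lemma pnorm_tmazur:
  assumes "0 < p" "0 < q"
  shows "pnorm q A (tmazur p q A f) = pnorm p A f"
proof -
  have "pnorm q A (tmazur p q A f) = pnorm p A f powr (1 - p / q) * pnorm p A f powr (p / q)"
    unfolding tmazur_def using assms by (subst pnorm_cmult) (auto simp: pnorm_spow)
  then show ?thesis using assms by (simp flip: powr_add)
qed

lemma pnorm_tmazur_diff_le:
  assumes A: "finite A" and q: "1 \<le> q" "q \<le> p"
  shows "pnorm q A (\<lambda>i. tmazur p q A f i - tmazur p q A g i)
    \<le> 3 * (p / q) * pnorm p A (\<lambda>i. f i - g i)"
proof -
  define r where "r = p / q"
  have r: "1 \<le> r" using q by (simp add: r_def)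
  have main: "pnorm q A (\<lambda>i. tmazur p q A f i - tmazur p q A g i)
      \<le> 3 * (p / q) * pnorm p A (\<lambda>i. f i - g i)"
    if le: "pnorm p A g \<le> pnorm p A f" for f g
  proof -
    define a b D where "a = pnorm p A f" and "b = pnorm p A g" and "D = pnorm p A (\<lambda>i. f i - g i)"
    have b0: "0 \<le> b" and D0: "0 \<le> D" and ba: "b \<le> a" using le by (simp_all add: a_def b_def D_def)
    have abD: "a - b \<le> D"
      using pnorm_triangle[OF A, of p "\<lambda>i. f i - g i" g] q by (simp add: a_def b_def D_def)
    define F G where "F i = spow r (f i) - spow r (g i)" and "G i = spow r (g i)" for i
    show ?thesis
    proof (cases "a = 0")
      case True
      then have "a = 0" "b = 0" using b0 ba by auto
      then have "pnorm q A (\<lambda>i. tmazur p q A f i - tmazur p q A g i) = pnorm q A (\<lambda>i. 0)"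
        by (simp add: tmazur_def flip: a_def b_def)
      also have "\<dots> = 0" by (simp add: pnorm_def)
      finally show ?thesis using q by simp
    next
      case False
      then have a: "0 < a" using b0 ba by simp
      have inv: "a powr (1 - r) * a powr (r - 1) = 1" using a by (simp flip: powr_add)
      \<comment> \<open>Keeping the factor of the larger norm a with \<open>F\<close> cancels the
        \<open>a powr (r - 1)\<close> from the bound on \<open>F\<close>; the change of factor
        multiplies only the smaller function's image \<open>G\<close>.\<close>
      have "pnorm q A (\<lambda>i. tmazur p q A f i - tmazur p q A g i)
          = pnorm q A (\<lambda>i. a powr (1 - r) * F i + (a powr (1 - r) - b powr (1 - r)) * G i)"
        by (simp add: tmazur_def F_def G_def a_def b_def r_def algebra_simps)
      also have "\<dots> \<le> a powr (1 - r) * pnorm q A F + \<bar>a powr (1 - r) - b powr (1 - r)\<bar> * pnorm q A G"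
        using pnorm_triangle[OF A q(1), of "\<lambda>i. a powr (1 - r) * F i"
            "\<lambda>i. (a powr (1 - r) - b powr (1 - r)) * G i"] q
        by (simp add: pnorm_cmult)
      also have "a powr (1 - r) * pnorm q A F \<le> a powr (1 - r) * (2 * r * D * a powr (r - 1))"
        unfolding F_def r_def D_def a_def
        using A q le by (intro mult_left_mono pnorm_spow_diff_le) auto
      also have "\<dots> = 2 * r * D" using inv by (simp add: mult_ac)
      also have "\<bar>a powr (1 - r) - b powr (1 - r)\<bar> * pnorm q A G \<le> r * D"
      \<comment> \<open>Since \<open>0 powr (1 - r) = 0\<close>, the factor is not decreasing at 0,
        so b = 0 is treated apart; there \<open>G\<close> has norm 0.\<close>
      proof (cases "b = 0")
        case True
        then have "pnorm q A G = 0" using q by (simp add: G_def[abs_def] r_def pnorm_spow flip: b_def)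
        then show ?thesis using r D0 by simp
      next
        case False
        then have b: "0 < b" using b0 by simp
        have G: "pnorm q A G = b powr r"
          using q by (simp add: G_def[abs_def] r_def pnorm_spow b_def)
        have mono: "a powr (1 - r) \<le> b powr (1 - r)"
          using b ba r by (intro powr_mono2') auto
        have "\<bar>a powr (1 - r) - b powr (1 - r)\<bar> * pnorm q A G = b - a * (b / a) powr r"
          using mono a b unfolding G by (simp add: powr_diff powr_divide field_simps)
        also have "\<dots> \<le> b - a * (1 + r * (b / a - 1))"
          using a b r by (intro diff_left_mono mult_left_mono bernoulli_powr) auto
        also have "\<dots> = (r - 1) * (a - b)" using a by (simp add: field_simps)
        also have "\<dots> \<le> r * D" using abD ba r by (intro mult_mono) auto
        finally show ?thesis .
      qed
      finally show ?thesis by (simp add: r_def D_def)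
    qed
  qed
  show ?thesis
  proof (cases "pnorm p A g \<le> pnorm p A f")
    case True
    then show ?thesis by (rule main)
  next
    case False
    then have "pnorm p A f \<le> pnorm p A g" by simp
    from main[OF this] show ?thesis
      by (subst (1 2) pnorm_minus_commute)
  qed
qed

section \<open>Sums over pairs, compared with sums of norms\<close>

text \<open>If u x is nonzero, every y not strictly on its side of the median 0 satisfies |u x - u
  y| \<ge> |u x|, and such y make up at least half of P.\<close>

lemma sum_powr_diff_median_ge:
  fixes u :: "'b \<Rightarrow> real"
  assumes P: "finite P" and q: "0 \<le> q"
    and med: "card {x \<in> P. u x < 0} = card {x \<in> P. u x > 0}"
  shows "real (card P) / 2 * (\<Sum>x\<in>P. \<bar>u x\<bar> powr q) \<le> (\<Sum>x\<in>P. \<Sum>y\<in>P. \<bar>u x - u y\<bar> powr q)"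
proof -
  \<comment> \<open>The two strict sides are disjoint and equally large, so neither exceeds half of
    P.\<close>
  have half: "real (card P) / 2 \<le> real (card {y \<in> P. \<not> Q y})"
    if "Q = (\<lambda>y. u y > 0) \<or> Q = (\<lambda>y. u y < 0)" for Q
  proof -
    have "card {y\<in>P. u y > 0} + card {y\<in>P. u y < 0} = card ({y\<in>P. u y > 0} \<union> {y\<in>P. u y < 0})"
      using P by (intro card_Un_disjoint[symmetric]) auto
    also have "\<dots> \<le> card P" using P by (intro card_mono) auto
    finally have "2 * card {y\<in>P. Q y} \<le> card P" using that med by auto
    moreover have "{y \<in> P. \<not> Q y} = P - {y \<in> P. Q y}" by auto
    then have "card {y \<in> P. \<not> Q y} = card P - card {y\<in>P. Q y}"
      using P by (simp add: card_Diff_subset)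
    ultimately show ?thesis by linarith
  qed
  have "real (card P) / 2 * \<bar>u x\<bar> powr q \<le> (\<Sum>y\<in>P. \<bar>u x - u y\<bar> powr q)" if "x \<in> P" for x
  proof (cases "u x = 0")
    case True
    then show ?thesis by (simp add: sum_nonneg)
  next
    case False
    define Q where "Q = (if u x > 0 then (\<lambda>y. u y > 0) else (\<lambda>y. u y < 0))"
    have "real (card P) / 2 * \<bar>u x\<bar> powr q \<le> real (card {y \<in> P. \<not> Q y}) * \<bar>u x\<bar> powr q"
      by (intro mult_right_mono half) (auto simp: Q_def)
    also have "\<dots> = (\<Sum>y\<in>{y \<in> P. \<not> Q y}. \<bar>u x\<bar> powr q)" by simp
    also have "\<dots> \<le> (\<Sum>y\<in>{y \<in> P. \<not> Q y}. \<bar>u x - u y\<bar> powr q)"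
      using q False by (intro sum_mono powr_mono2) (auto simp: Q_def split: if_splits)
    also have "\<dots> \<le> (\<Sum>y\<in>P. \<bar>u x - u y\<bar> powr q)"
      using P by (intro sum_mono2) auto
    finally show ?thesis .
  qed
  then show ?thesis unfolding sum_distrib_left by (rule sum_mono)
qed

text \<open>The q-th power of the q-norm splits over coordinates, so the scalar estimate is summed
  over i.\<close>

lemma sum_pnorm_diff_median_ge:
  fixes h :: "'b \<Rightarrow> 'i \<Rightarrow> real"
  assumes P: "finite P" and q: "0 < q"
    and med: "\<And>i. i \<in> A \<Longrightarrow> card {x \<in> P. h x i < 0} = card {x \<in> P. h x i > 0}"
  shows "real (card P) / 2 * (\<Sum>x\<in>P. pnorm q A (h x) powr q)
    \<le> (\<Sum>x\<in>P. \<Sum>y\<in>P. pnorm q A (\<lambda>i. h x i - h y i) powr q)"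
proof -
  have "real (card P) / 2 * (\<Sum>x\<in>P. pnorm q A (h x) powr q)
      = (\<Sum>i\<in>A. real (card P) / 2 * (\<Sum>x\<in>P. \<bar>h x i\<bar> powr q))"
    unfolding pnorm_powr[OF q] sum_distrib_left[symmetric] by (subst sum.swap) simp
  also have "\<dots> \<le> (\<Sum>i\<in>A. \<Sum>x\<in>P. \<Sum>y\<in>P. \<bar>h x i - h y i\<bar> powr q)"
    using P q med by (intro sum_mono sum_powr_diff_median_ge) auto
  also have "\<dots> = (\<Sum>x\<in>P. \<Sum>y\<in>P. pnorm q A (\<lambda>i. h x i - h y i) powr q)"
    unfolding pnorm_powr[OF q]
    by (subst sum.swap, intro sum.cong refl, subst sum.swap) simp
  finally show ?thesis .
qed

text \<open>Compares both points with 0 by the triangle inequality; convexity of the q-th power at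
  the midpoint of the two norms gives the factor 2^q.\<close>

lemma sum_pnorm_diff_le:
  fixes f :: "'b \<Rightarrow> 'i \<Rightarrow> real"
  assumes A: "finite A" and q: "1 \<le> q" and p: "1 \<le> p"
  shows "(\<Sum>x\<in>P. \<Sum>y\<in>P. pnorm p A (\<lambda>i. f x i - f y i) powr q)
    \<le> 2 powr q * real (card P) * (\<Sum>x\<in>P. pnorm p A (f x) powr q)"
proof -
  have "(\<Sum>x\<in>P. \<Sum>y\<in>P. pnorm p A (\<lambda>i. f x i - f y i) powr q)
      \<le> (\<Sum>x\<in>P. \<Sum>y\<in>P. 2 powr q * (1/2 * pnorm p A (f x) powr q + 1/2 * pnorm p A (f y) powr q))"
  proof (intro sum_mono)
    fix x y
    have "pnorm p A (\<lambda>i. f x i - f y i) \<le> pnorm p A (f x) + pnorm p A (f y)"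
      using pnorm_triangle[OF A p, of "f x" "\<lambda>i. - f y i"] by (simp add: pnorm_def)
    then have "pnorm p A (\<lambda>i. f x i - f y i) powr q
        \<le> (2 * (1/2 * pnorm p A (f x) + 1/2 * pnorm p A (f y))) powr q"
      using q by (intro powr_mono2) auto
    also have "\<dots> \<le> 2 powr q * (1/2 * pnorm p A (f x) powr q + 1/2 * pnorm p A (f y) powr q)"
      unfolding powr_mult using q by (intro mult_left_mono powr_convex_nonneg) auto
    finally show "pnorm p A (\<lambda>i. f x i - f y i) powr q
        \<le> 2 powr q * (1/2 * pnorm p A (f x) powr q + 1/2 * pnorm p A (f y) powr q)" .
  qed
  also have "\<dots> = 2 powr q * real (card P) * (\<Sum>x\<in>P. pnorm p A (f x) powr q)"
    by (simp add: sum.distrib flip: sum_distrib_left sum_divide_distrib)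
  finally show ?thesis .
qed

section \<open>Transfer to vectors and Lipschitz constants\<close>

lemma lp_norm_eq_pnorm: "lp_norm p x = pnorm p {..<dim_vec x} (\<lambda>i. x $ i)"
  unfolding lp_norm_def pnorm_def ..

lemma lp_dist_eq_pnorm:
  assumes "x \<in> carrier_vec d" "y \<in> carrier_vec d"
  shows "lp_dist p x y = pnorm p {..<d} (\<lambda>i. x $ i - y $ i)"
proof -
  have "dim_vec (x - y) = d" "\<And>i. i < d \<Longrightarrow> (x - y) $ i = x $ i - y $ i" using assms by auto
  then show ?thesis unfolding lp_dist_def lp_norm_def pnorm_def by simp
qed

lemma mazur_tilde_carrier: "x \<in> carrier_vec d \<Longrightarrow> mazur_tilde p q x \<in> carrier_vec d"
  by (auto simp: mazur_tilde_def mazur_def)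

text \<open>Covers \<open>x = 0\<close> as well, where the right-hand side vanishes because \<open>0 powr e = 0\<close> for every \<open>e\<close>.\<close>

lemma mazur_tilde_index:
  assumes x: "x \<in> carrier_vec d" and i: "i < d" and p: "0 < p"
  shows "mazur_tilde p q x $ i = tmazur p q {..<d} (\<lambda>i. x $ i) i"
proof (cases "x = 0\<^sub>v d")
  case True
  then show ?thesis using i by (simp add: mazur_tilde_def tmazur_def spow_def)
next
  case False
  define a where "a = pnorm p {..<d} (\<lambda>i. x $ i)"
  have "a \<noteq> 0"
  proof
    assume "a = 0"
    then have "\<forall>i\<in>{..<d}. x $ i = 0" using p by (simp add: a_def pnorm_eq_0_iff)
    then have "x = 0\<^sub>v d" using x by (intro eq_vecI) auto
    then show False using False by simp
  qed
  then have a: "0 < a" by (simp add: a_def less_le)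
  have "mazur_tilde p q x $ i = a * (sgn (x $ i / a) * \<bar>x $ i / a\<bar> powr (p / q))"
    using False x i by (simp add: mazur_tilde_def mazur_def lp_norm_eq_pnorm a_def)
  also have "\<dots> = tmazur p q {..<d} (\<lambda>i. x $ i) i"
    using a by (simp add: tmazur_def spow_def powr_divide powr_diff sgn_divide flip: a_def)
  finally show ?thesis .
qed

text \<open>The infimum is attained from a set bounded below by 0, as \<open>lip_bound\<close>
  includes nonnegativity.\<close>

lemma lip_const_le: "lip_bound X dX dY g L \<Longrightarrow> lip_const X dX dY g \<le> L"
  unfolding lip_const_def
  by (rule cInf_lower, simp, rule bdd_belowI[of _ 0], simp add: lip_bound_def)

lemma lip_const_nonneg: "lip_bound X dX dY g L \<Longrightarrow> 0 \<le> lip_const X dX dY g"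
  unfolding lip_const_def by (rule cInf_greatest, blast, simp add: lip_bound_def)

lemma lp_dist_mazur_tilde:
  assumes "x \<in> carrier_vec d" "y \<in> carrier_vec d" "t \<in> carrier_vec d" "0 < p"
  shows "lp_dist q (mazur_tilde p q (x - t)) (mazur_tilde p q (y - t))
    = pnorm q {..<d} (\<lambda>i. tmazur p q {..<d} (\<lambda>i. x $ i - t $ i) i - tmazur p q {..<d} (\<lambda>i. y $ i - t $ i) i)"
proof -
  have eq: "mazur_tilde p q (z - t) $ i = tmazur p q {..<d} (\<lambda>i. z $ i - t $ i) i"
    if "z \<in> carrier_vec d" "i < d" for z i
  proof -
    have "z - t \<in> carrier_vec d" using that assms by simp
    from mazur_tilde_index[OF this that(2) assms(4)]
    show ?thesis using that assms by (simp add: tmazur_def pnorm_def)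
  qed
  have "lp_dist q (mazur_tilde p q (x - t)) (mazur_tilde p q (y - t))
    = pnorm q {..<d} (\<lambda>i. mazur_tilde p q (x - t) $ i - mazur_tilde p q (y - t) $ i)"
    using assms by (intro lp_dist_eq_pnorm mazur_tilde_carrier) auto
  also have "\<dots> = pnorm q {..<d} (\<lambda>i. tmazur p q {..<d} (\<lambda>i. x $ i - t $ i) i
      - tmazur p q {..<d} (\<lambda>i. y $ i - t $ i) i)"
    unfolding pnorm_def using assms by (simp add: eq)
  finally show ?thesis .
qed

lemma lip_bound_mazur_tilde:
  assumes q: "1 \<le> q" "q \<le> p" and t: "t \<in> carrier_vec d"
  shows "lip_bound (carrier_vec d) (lp_dist p) (lp_dist q)
    (\<lambda>x. mazur_tilde p q (x - t)) (3 * (p / q))"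
  unfolding lip_bound_def
proof (intro conjI ballI)
  fix x y :: "real vec" assume xy: "x \<in> carrier_vec d" "y \<in> carrier_vec d"
  show "lp_dist q (mazur_tilde p q (x - t)) (mazur_tilde p q (y - t)) \<le> 3 * (p / q) * lp_dist p x y"
    using pnorm_tmazur_diff_le[OF _ q, of "{..<d}" "\<lambda>i. x $ i - t $ i" "\<lambda>i. y $ i - t $ i"] xy t q
    by (simp add: lp_dist_mazur_tilde lp_dist_eq_pnorm)
qed (use q in simp)

section \<open>The average distortion bound\<close>

lemma has_average_distortion_mazur_tilde:
  assumes q: "1 \<le> q" "q \<le> p" and P: "P \<subseteq> carrier_vec d" "finite P" and t: "t \<in> carrier_vec d"
    and med: "\<And>i. i < d \<Longrightarrow> card {x \<in> P. x $ i < t $ i} = card {x \<in> P. x $ i > t $ i}"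
  shows "has_average_distortion d p q (\<lambda>x. mazur_tilde p q (x - t)) P (12 * (p / q))"
proof -
  define A where "A = {..<d}"
  define f :: "real vec \<Rightarrow> nat \<Rightarrow> real" where "f x = (\<lambda>i. x $ i - t $ i)" for x
  define h where "h x = tmazur p q A (f x)" for x
  define g where "g = (\<lambda>x. mazur_tilde p q (x - t))"
  define D where "D = 12 * (p / q)"
  define L where "L = lip_const (carrier_vec d) (lp_dist p) (lp_dist q) g"
  define N where "N = (\<Sum>x\<in>P. pnorm p A (f x) powr q)"
  have N0: "0 \<le> N" by (simp add: N_def sum_nonneg)
  have D: "0 < D" using q by (simp add: D_def)
  have lip: "lip_bound (carrier_vec d) (lp_dist p) (lp_dist q) g (3 * (p / q))"
    unfolding g_def using q t by (rule lip_bound_mazur_tilde)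
  have L: "0 \<le> L" "L \<le> D / 4"
    using lip_const_nonneg[OF lip] lip_const_le[OF lip] by (auto simp: L_def D_def)
  have "L powr q / D powr q = (L / D) powr q" by (simp add: powr_divide)
  also have "\<dots> \<le> (1/4) powr q" using L D q by (intro powr_mono2) (auto simp: field_simps)
  finally have LD: "L powr q / D powr q \<le> (1/4) powr q" .
  \<comment> \<open>Where the coordinate is nonzero, the map multiplies its sign by a positive
    number, so the balance condition at t becomes the median condition at 0 for
    \<open>h\<close>.\<close>
  have sgn_h: "h x i < 0 \<longleftrightarrow> x $ i < t $ i" "h x i > 0 \<longleftrightarrow> x $ i > t $ i" if "i \<in> A" for x i
  proof -
    have nz: "pnorm p A (f x) \<noteq> 0" if "f x i \<noteq> 0"
      using that \<open>i \<in> A\<close> q pnorm_eq_0_iff[of A p "f x"] by (auto simp: A_def)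
    define c where "c = pnorm p A (f x) powr (1 - p / q) * \<bar>f x i\<bar> powr (p / q)"
    have c: "0 < c" if "f x i \<noteq> 0"
      using that nz by (simp add: c_def)
    have "h x i = c * sgn (f x i)"
      by (simp add: h_def tmazur_def spow_def c_def)
    then show "h x i < 0 \<longleftrightarrow> x $ i < t $ i" "h x i > 0 \<longleftrightarrow> x $ i > t $ i"
      using c by (cases "f x i = 0"; auto simp: f_def mult_less_0_iff zero_less_mult_iff)+
  qed
  have "(\<Sum>x\<in>P. \<Sum>y\<in>P. lp_dist p x y powr q)
      = (\<Sum>x\<in>P. \<Sum>y\<in>P. pnorm p A (\<lambda>i. f x i - f y i) powr q)"
    using P by (intro sum.cong refl) (auto simp: A_def f_def lp_dist_eq_pnorm[where d = d] subset_iff)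
  also have "\<dots> \<le> 2 powr q * real (card P) * N"
    unfolding N_def using q by (intro sum_pnorm_diff_le) (auto simp: A_def)
  finally have up: "(\<Sum>x\<in>P. \<Sum>y\<in>P. lp_dist p x y powr q) \<le> 2 powr q * real (card P) * N" .
  have "real (card P) / 2 * N = real (card P) / 2 * (\<Sum>x\<in>P. pnorm q A (h x) powr q)"
    using q by (simp add: N_def h_def pnorm_tmazur)
  also have "\<dots> \<le> (\<Sum>x\<in>P. \<Sum>y\<in>P. pnorm q A (\<lambda>i. h x i - h y i) powr q)"
    using P q med by (intro sum_pnorm_diff_median_ge) (auto simp: sgn_h A_def)
  also have "\<dots> = (\<Sum>x\<in>P. \<Sum>y\<in>P. lp_dist q (g x) (g y) powr q)"
    using P t q
    by (intro sum.cong refl) (auto simp: g_def h_def f_def A_def lp_dist_mazur_tilde[where d = d] subset_iff)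
  finally have low: "real (card P) / 2 * N \<le> (\<Sum>x\<in>P. \<Sum>y\<in>P. lp_dist q (g x) (g y) powr q)" .
  \<comment> \<open>The ratio 4 between \<open>D\<close> and the Lipschitz bound pays for both
    losses: one factor 2 absorbs the 2^q of the triangle inequality, the other leaves (1/2)^q \<le>
    1/2, the share kept by the median argument.\<close>
  have "L powr q / D powr q * (\<Sum>x\<in>P. \<Sum>y\<in>P. lp_dist p x y powr q)
      \<le> (1/4) powr q * (2 powr q * real (card P) * N)"
    using LD up by (intro mult_mono sum_nonneg) auto
  also have "\<dots> = (1/2) powr q * (real (card P) * N)"
    by (simp flip: powr_mult mult.assoc)
  also have "\<dots> \<le> (1/2) powr 1 * (real (card P) * N)"
    using N0 q by (intro mult_right_mono powr_mono') auto
  also have "\<dots> = real (card P) / 2 * N" by simp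
  also note low
  finally show ?thesis
    unfolding has_average_distortion_def using D lip by (auto simp: L_def g_def D_def)
qed

theorem theorem1p8:
  "\<exists>C\<^sub>0::real. 0 < C\<^sub>0 \<and>
     (\<forall>(d::nat) (n::nat) (p::real) (q::real) P t.
        p \<ge> q \<and> q \<ge> 1 \<and>
        P \<subseteq> carrier_vec d \<and> finite P \<and> card P = n \<and>
        t \<in> carrier_vec d \<and>
        (\<forall>i<d. card {x \<in> P. x $ i < t $ i} = card {x \<in> P. x $ i > t $ i})
        \<longrightarrow> (\<exists>D. D \<le> C\<^sub>0 * (p / q) \<and>
               has_average_distortion d p q (\<lambda>x. mazur_tilde p q (x - t)) P D))"
\<comment> \<open>The constant is 12 = 4 * 3, from the Lipschitz bound 3 p / q.\<close>
proof (rule exI[of _ 12], intro conjI allI impI)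
  fix d n :: nat and p q :: real and P :: "real vec set" and t :: "real vec"
  assume "p \<ge> q \<and> q \<ge> 1 \<and>
        P \<subseteq> carrier_vec d \<and> finite P \<and> card P = n \<and>
        t \<in> carrier_vec d \<and>
        (\<forall>i<d. card {x \<in> P. x $ i < t $ i} = card {x \<in> P. x $ i > t $ i})"
  then have "has_average_distortion d p q (\<lambda>x. mazur_tilde p q (x - t)) P (12 * (p / q))"
    by (intro has_average_distortion_mazur_tilde) blast+
  then show "\<exists>D. D \<le> 12 * (p / q) \<and>
      has_average_distortion d p q (\<lambda>x. mazur_tilde p q (x - t)) P D"
    by blast
qed simp

end
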